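(* $\pi(K_5^{(3)-}) \geq \frac{31097 + 277 \sqrt{277}}{59248} = 0.602673\ldots$.
   Context: A $3$-graph $H=(V,E)$ has $E\subseteq\binom{V}{3}$. $H$ is $F$-free if it contains no copy of $F$. $\mathrm{ex}(n,F)$ is the maximum number of edges of an $F$-free $3$-graph on $n$ vertices and $\pi(F)=\lim_{n\to\infty}\mathrm{ex}(n,F)/\binom{n}{3}$. $K_5^{(3)-}$ is the complete $3$-graph on $5$ vertices with one edge removed. *)

theory Defs
  imports Complex_Main "HOL-Library.Ramsey"
begin

text \<open>A 3-graph is a pair \<open>(V, E)\<close>; \<open>nsets V 3\<close> is the set of 3-element subsets of \<open>V\<close>.
  Vertex sets are finite, as is implicit when counting edges.\<close>

type_synonym 'a hypergraph = "'a set \<times> 'a set set"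

definition three_graph :: "'a hypergraph \<Rightarrow> bool" where
  "three_graph H \<longleftrightarrow> finite (fst H) \<and> snd H \<subseteq> nsets (fst H) 3"

text \<open>A copy of \<open>F\<close> is a not necessarily induced subgraph isomorphic to \<open>F\<close>.\<close>

definition contains_copy :: "'a hypergraph \<Rightarrow> 'b hypergraph \<Rightarrow> bool" where
  "contains_copy H F \<longleftrightarrow>
     (\<exists>f. inj_on f (fst F) \<and> f ` fst F \<subseteq> fst H \<and> (\<forall>e\<in>snd F. f ` e \<in> snd H))"

definition is_free :: "'a hypergraph \<Rightarrow> 'b hypergraph \<Rightarrow> bool" where
  "is_free H F \<longleftrightarrow> \<not> contains_copy H F"

text \<open>Every finite 3-graph is isomorphic to one whose vertices are natural numbers, so hosts on
  \<^typ>\<open>nat\<close> suffice. The set below is finite because all its elements are at most \<open>n choose 3\<close>, and it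
  contains 0 whenever \<open>F\<close> has an edge.\<close>

definition ex_number :: "nat \<Rightarrow> 'b hypergraph \<Rightarrow> nat" where
  "ex_number n F = Max {card (snd H) | H :: nat hypergraph.
                   three_graph H \<and> card (fst H) = n \<and> is_free H F}"

definition turan_density :: "'b hypergraph \<Rightarrow> real" where
  "turan_density F = lim (\<lambda>n. real (ex_number n F) / real (n choose 3))"

text \<open>All choices of the removed edge give isomorphic 3-graphs.\<close>

definition K5_minus :: "nat hypergraph" where
  "K5_minus = ({..<5}, nsets {..<5} 3 - {{0, 1, 2}})"

end

theory Submission
  imports Defs
begin

text \<open>
  Colour the vertices by residues modulo 7 and let \<open>i \<rightarrow> j\<close> mean \<open>j - i \<in> {1, 3}\<close>, so that the sets
  \<open>{i, i + 1, i + 3}\<close> are the lines of the Fano plane. Take as edges the triples coloured \<open>i, j, k\<close>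
  (distinct) where \<open>{i, j, k}\<close> is not a line, and those coloured \<open>i, i, j\<close> with \<open>i \<rightarrow> j\<close>.
  A five-point subset of the Fano plane contains exactly two lines, so five vertices of distinct
  colours miss two edges; a finite check shows that the same holds for repeated colours.
  Of the \<open>7 ^ 3\<close> ordered colour triples, \<open>28 * 6 + 14 * 3 = 210\<close> are edges, so the density of the
  balanced construction tends to \<open>30 / 49 = 0.612\<dots> > 0.6027\<dots>\<close>.
\<close>

section \<open>Extremal numbers and convergence of the edge densities\<close>

lemma free_edgeless: "snd F \<noteq> {} \<Longrightarrow> is_free (V, {}) F"
  by (auto simp: is_free_def contains_copy_def)

lemma finite_ex_number_set:
  "finite {card (snd H) | H :: nat hypergraph. three_graph H \<and> card (fst H) = n \<and> is_free H F}"
proof (rule finite_subset)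
  show "{card (snd H) | H :: nat hypergraph. three_graph H \<and> card (fst H) = n \<and> is_free H F} \<subseteq> {..n choose 3}"
    using card_mono[OF finite_imp_finite_nsets, of "fst H" "snd H" 3 for H :: "nat hypergraph"]
    by (auto simp: three_graph_def card_nsets)
qed simp

lemma card_le_ex_number:
  fixes H :: "nat hypergraph"
  assumes "three_graph H" "is_free H F"
  shows "card (snd H) \<le> ex_number (card (fst H)) F"
  unfolding ex_number_def using assms by (intro Max_ge finite_ex_number_set) blast

lemma ex_number_attained:
  assumes "snd F \<noteq> {}"
  obtains H :: "nat hypergraph"
  where "three_graph H" "card (fst H) = n" "is_free H F" "card (snd H) = ex_number n F"
proof -
  let ?S = "{card (snd H) | H :: nat hypergraph. three_graph H \<and> card (fst H) = n \<and> is_free H F}"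
  have "three_graph ({..<n}, {})" "card (fst ({..<n}, {} :: nat set set)) = n"
    by (auto simp: three_graph_def)
  with free_edgeless[OF assms] have "?S \<noteq> {}" by blast
  from Max_in[OF finite_ex_number_set this] show ?thesis
    using that unfolding ex_number_def by auto
qed

text \<open>Double counting of pairs of a vertex and an edge avoiding it: each edge avoids all but
  three vertices.\<close>

lemma sum_card_delete_vertex:
  assumes "three_graph H"
  shows "(\<Sum>v\<in>fst H. card {e \<in> snd H. v \<notin> e}) = (card (fst H) - 3) * card (snd H)"
proof -
  have fin: "finite (fst H)" "finite (snd H)"
    using assms finite_imp_finite_nsets finite_subset unfolding three_graph_def by metis+
  have "card {v \<in> fst H. v \<notin> e} = card (fst H) - 3" if "e \<in> snd H" for e
  proof -
    have "e \<subseteq> fst H" "card e = 3" "finite e" using that assms by (auto simp: three_graph_def nsets_def)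
    moreover have "{v \<in> fst H. v \<notin> e} = fst H - e" by auto
    ultimately show ?thesis by (simp add: card_Diff_subset)
  qed
  then have "(\<Sum>e\<in>snd H. card {v \<in> fst H. v \<notin> e}) = (card (fst H) - 3) * card (snd H)" by simp
  then show ?thesis
    using sum_multicount_gen[of "fst H" "snd H" "\<lambda>v e. v \<notin> e" "\<lambda>e. card {v \<in> fst H. v \<notin> e}"] fin by simp
qed

text \<open>Averaging over vertex deletions in an extremal host: each leaves an
  \<open>F\<close>-free 3-graph on \<open>n\<close> vertices. The factor \<open>n - 2\<close> is
  \<open>Suc n - 3\<close>, the number of deletions that an edge survives.\<close>

lemma ex_number_Suc_le:
  assumes "snd F \<noteq> {}"
  shows "(n - 2) * ex_number (Suc n) F \<le> Suc n * ex_number n F"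
proof -
  obtain H :: "nat hypergraph" where H: "three_graph H" "card (fst H) = Suc n" "is_free H F"
    "card (snd H) = ex_number (Suc n) F"
    using ex_number_attained[OF assms] .
  have "card {e \<in> snd H. v \<notin> e} \<le> ex_number n F" if "v \<in> fst H" for v
  proof -
    let ?H = "(fst H - {v}, {e \<in> snd H. v \<notin> e})"
    have "three_graph ?H" using H(1) by (auto simp: three_graph_def nsets_def)
    moreover have "is_free ?H F"
      using H(3) unfolding is_free_def contains_copy_def by (simp add: subset_Diff_insert) blast
    moreover have "card (fst ?H) = n" using H(2) that by simp
    ultimately show ?thesis using card_le_ex_number[of ?H F] by simp
  qed
  then have "(\<Sum>v\<in>fst H. card {e \<in> snd H. v \<notin> e}) \<le> card (fst H) * ex_number n F"
    using sum_bounded_above[of "fst H" _ "ex_number n F"] by simp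
  with sum_card_delete_vertex[OF H(1)] H show ?thesis by simp
qed

lemma ex_density_Suc_le:
  assumes "snd F \<noteq> {}" "n \<ge> 3"
  shows "real (ex_number (Suc n) F) / real (Suc n choose 3) \<le> real (ex_number n F) / real (n choose 3)"
proof -
  have "(n - 2) * (Suc n choose 3) = Suc n * (n choose 3)"
    using binomial_absorb_comp[of "Suc n" 3] by simp
  then have "real (n - 2) * real (Suc n choose 3) = real (Suc n) * real (n choose 3)"
    by (metis of_nat_mult)
  moreover have "real (n - 2) * real (ex_number (Suc n) F) \<le> real (Suc n) * real (ex_number n F)"
    using ex_number_Suc_le[OF assms(1), of n] by (metis of_nat_le_iff of_nat_mult)
  then have "real (n - 2) * real (ex_number (Suc n) F) * real (n choose 3)
      \<le> real (Suc n) * real (ex_number n F) * real (n choose 3)"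
    by (intro mult_right_mono) auto
  ultimately have "real (n - 2) * (real (ex_number (Suc n) F) * real (n choose 3))
      \<le> real (n - 2) * (real (ex_number n F) * real (Suc n choose 3))"
    by (metis (no_types) mult.assoc mult.commute)
  moreover have "real (n - 2) > 0" "real (n choose 3) > 0" "real (Suc n choose 3) > 0"
    using assms(2) by (simp_all del: binomial_Suc_Suc)
  ultimately show ?thesis
    by (simp add: divide_le_eq pos_le_divide_eq mult.commute del: binomial_Suc_Suc)
qed

lemma turan_density_LIMSEQ:
  assumes "snd F \<noteq> {}"
  shows "(\<lambda>n. real (ex_number n F) / real (n choose 3)) \<longlonglongrightarrow> turan_density F"
proof -
  let ?d = "\<lambda>n. real (ex_number n F) / real (n choose 3)"
  \<comment> \<open>Below index 3 the binomial is 0 and so is the quotient, hence monotonicity can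
    fail before the shift.\<close>
  have "decseq (\<lambda>n. ?d (n + 3))"
    using ex_density_Suc_le[OF assms, of "n + 3" for n]
    by (intro decseq_SucI) (simp del: binomial_Suc_Suc of_nat_Suc add_Suc_right)
  then obtain l where "(\<lambda>n. ?d (n + 3)) \<longlonglongrightarrow> l"
    by (rule decseq_convergent[where B = 0]) auto
  then have "?d \<longlonglongrightarrow> l" by (rule LIMSEQ_offset)
  then show ?thesis unfolding turan_density_def by (simp add: limI)
qed

section \<open>The colour pattern from the Fano plane\<close>

text \<open>For residues below 7, adding 7 before subtracting avoids truncation at 0.\<close>

definition fano_arc :: "nat \<Rightarrow> nat \<Rightarrow> bool" where
  "fano_arc a b \<longleftrightarrow> (b + 7 - a) mod 7 \<in> {1, 3}"

text \<open>Distinct colours form a line exactly when one of them has arcs to both others. Three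
  equal colours give no edge, since \<open>fano_arc a a\<close> is false.\<close>

definition fano_triple :: "nat \<Rightarrow> nat \<Rightarrow> nat \<Rightarrow> bool" where
  "fano_triple a b c \<longleftrightarrow>
     (if a = b then fano_arc a c else if a = c then fano_arc a b else if b = c then fano_arc b a
      else \<not> (fano_arc a b \<and> fano_arc a c \<or> fano_arc b a \<and> fano_arc b c \<or> fano_arc c a \<and> fano_arc c b))"

lemma fano_triple_rotate: "fano_triple a b c \<longleftrightarrow> fano_triple b c a"
  and fano_triple_swap: "fano_triple a b c \<longleftrightarrow> fano_triple b a c"
  by (auto simp: fano_triple_def)

text \<open>A copy of \<open>K5_minus\<close> in which \<open>x\<close>, \<open>y\<close> are the two vertices outside the missing edge amounts to
  a triangle in the common link of \<open>x\<close> and \<open>y\<close>, which keeps the case check small.\<close>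

definition common_link :: "nat \<Rightarrow> nat \<Rightarrow> (nat \<times> nat) list" where
  "common_link x y = filter (\<lambda>(z, u). fano_triple x z u \<and> fano_triple y z u)
     (List.product (filter (fano_triple x y) [0..<7]) (filter (fano_triple x y) [0..<7]))"

definition triangle_free :: "(nat \<times> nat) list \<Rightarrow> bool" where
  "triangle_free es \<longleftrightarrow> (\<forall>(z, u)\<in>set es. \<forall>(z', v)\<in>set es. z' = z \<longrightarrow> (u, v) \<notin> set es)"

lemma triangle_free_common_link: "\<forall>x\<in>set [0..<7]. \<forall>y\<in>set [0..<7]. triangle_free (common_link x y)"
  by code_simp

text \<open>The colours may coincide, so this covers any five vertices of a blow-up. The nine
  triples are all those other than \<open>z\<close>, \<open>u\<close>, \<open>v\<close>.\<close>

lemma fano_triple_no_K5_minus: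
  assumes "x < 7" "y < 7" "z < 7" "u < 7" "v < 7"
    and "fano_triple x y z" "fano_triple x y u" "fano_triple x y v"
    and "fano_triple x z u" "fano_triple x z v" "fano_triple x u v"
    and "fano_triple y z u" "fano_triple y z v" "fano_triple y u v"
  shows False
proof -
  have "(z, u) \<in> set (common_link x y)" "(z, v) \<in> set (common_link x y)"
    "(u, v) \<in> set (common_link x y)"
    using assms by (auto simp: common_link_def)
  moreover have "triangle_free (common_link x y)"
    using triangle_free_common_link assms(1,2) by simp
  ultimately show ?thesis unfolding triangle_free_def by blast
qed

lemma fano_triple_count:
  "(\<Sum>a<7. \<Sum>b<7. \<Sum>c<7. of_bool (fano_triple a b c) :: nat) = 210"
  by code_simp

text \<open>The range splits into \<open>m\<close> blocks of length \<open>k\<close>, each meeting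
  every residue once.\<close>

lemma sum_mod_lessThan:
  fixes g :: "nat \<Rightarrow> nat"
  shows "(\<Sum>i<m * k. g (i mod k)) = m * (\<Sum>r<k. g r)"
proof -
  have "(\<Sum>i<m * k. g (i mod k)) = (\<Sum>j<m. \<Sum>i = j * k..<j * k + k. g (i mod k))"
    by (simp add: sum.nat_group)
  also have "\<dots> = (\<Sum>j<m. \<Sum>r<k. g r)"
  proof (rule sum.cong[OF refl])
    fix j
    have "(\<Sum>i = j * k..<j * k + k. g (i mod k)) = (\<Sum>r<k. g ((r + j * k) mod k))"
      using sum.shift_bounds_nat_ivl[of "\<lambda>i. g (i mod k)" 0 "j * k" k]
      by (simp add: lessThan_atLeast0 add.commute)
    then show "(\<Sum>i = j * k..<j * k + k. g (i mod k)) = (\<Sum>r<k. g r)" by simp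
  qed
  finally show ?thesis by simp
qed

lemma triple_eq_cases:
  assumes "{x, y, z} = {u, v, w}" "u \<noteq> v" "u \<noteq> w" "v \<noteq> w"
  shows "(x, y, z) \<in> {(u, v, w), (u, w, v), (v, u, w), (v, w, u), (w, u, v), (w, v, u)}"
proof -
  have "x \<in> {u, v, w}" "y \<in> {u, v, w}" "z \<in> {u, v, w}" "u \<in> {x, y, z}" "v \<in> {x, y, z}" "w \<in> {x, y, z}"
    using assms(1) by blast+
  then show ?thesis using assms(2-) by fastforce
qed

section \<open>The balanced blow-up and its freeness\<close>

text \<open>Edges are sets but \<open>fano_triple\<close> takes ordered arguments; by its symmetry,
  the ordering chosen by the existential is immaterial.\<close>

definition fano_host :: "nat \<Rightarrow> nat hypergraph" where
  "fano_host n = ({..<n}, {e \<in> nsets {..<n} 3.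
     \<exists>u v w. e = {u, v, w} \<and> fano_triple (u mod 7) (v mod 7) (w mod 7)})"

lemma three_graph_fano_host: "three_graph (fano_host n)"
  by (auto simp: three_graph_def fano_host_def)

lemma fano_host_edge_iff:
  assumes "u \<noteq> v" "u \<noteq> w" "v \<noteq> w"
  shows "{u, v, w} \<in> snd (fano_host n) \<longleftrightarrow>
    u < n \<and> v < n \<and> w < n \<and> fano_triple (u mod 7) (v mod 7) (w mod 7)" (is "?l \<longleftrightarrow> ?r")
proof
  assume ?l
  then obtain x y z where xyz: "{x, y, z} = {u, v, w}" "fano_triple (x mod 7) (y mod 7) (z mod 7)"
    by (auto simp: fano_host_def)
  then have "fano_triple (u mod 7) (v mod 7) (w mod 7)"
    using triple_eq_cases[OF xyz(1) assms] fano_triple_rotate fano_triple_swap by blast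
  with \<open>?l\<close> show ?r by (auto simp: fano_host_def nsets_def)
next
  assume ?r
  with assms show ?l by (auto simp: fano_host_def nsets_def)
qed

lemma fano_host_K5_minus_free: "is_free (fano_host n) K5_minus"
  unfolding is_free_def
proof
  assume "contains_copy (fano_host n) K5_minus"
  then obtain f :: "nat \<Rightarrow> nat" where inj: "inj_on f {..<5}"
    and edges: "\<And>e. e \<in> nsets {..<5} 3 - {{0, 1, 2}} \<Longrightarrow> f ` e \<in> snd (fano_host n)"
    unfolding contains_copy_def K5_minus_def by auto
  define c where "c i = f i mod 7" for i
  have c: "c i < 7" for i by (simp add: c_def)
  \<comment> \<open>With \<open>3 \<le> i\<close> the triple cannot be the removed edge
    \<open>{0, 1, 2}\<close>; the nine triples required below can all be led by 3 or 4.\<close>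
  have T: "fano_triple (c i) (c j) (c k)"
    if "i \<noteq> j" "i \<noteq> k" "j \<noteq> k" "i < 5" "j < 5" "k < 5" "3 \<le> i" for i j k
  proof -
    have "i \<notin> {0, 1, 2}" using that by simp
    then have "{i, j, k} \<noteq> {0, 1, 2}" by blast
    moreover have "{i, j, k} \<in> nsets {..<5} 3" using that by (simp add: nsets_def)
    ultimately have "{f i, f j, f k} \<in> snd (fano_host n)" using edges[of "{i, j, k}"] by simp
    moreover have "f i \<noteq> f j" "f i \<noteq> f k" "f j \<noteq> f k"
      using inj that by (auto dest: inj_onD)
    ultimately show ?thesis unfolding c_def using fano_host_edge_iff by blast
  qed
  show False
    by (rule fano_triple_no_K5_minus[of "c 3" "c 4" "c 0" "c 1" "c 2"])
      (use c T in simp_all)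
qed

section \<open>Counting edges through ordered triples\<close>

lemma card_ordered_triples_le:
  assumes "finite E" and "\<And>e. e \<in> E \<Longrightarrow> card e = 3"
  shows "card {(x, y, z). {x, y, z} \<in> E} \<le> 6 * card E"
proof -
  have "card {(x, y, z). {x, y, z} = e} \<le> 6" if "e \<in> E" for e
  proof -
    obtain u v w where e: "e = {u, v, w}" "u \<noteq> v" "u \<noteq> w" "v \<noteq> w"
      using assms(2)[OF \<open>e \<in> E\<close>] by (auto simp: card_3_iff)
    let ?l = "[(u, v, w), (u, w, v), (v, u, w), (v, w, u), (w, u, v), (w, v, u)]"
    have "{(x, y, z). {x, y, z} = e} \<subseteq> set ?l"
    proof clarify
      fix x y z assume "e = {x, y, z}"
      then show "(x, y, z) \<in> set ?l"
        using triple_eq_cases[OF _ e(2-4), of x y z] e(1) by simp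
    qed
    then have "card {(x, y, z). {x, y, z} = e} \<le> card (set ?l)" by (intro card_mono finite_set)
    also have "\<dots> \<le> 6" using card_length[of ?l] by simp
    finally show ?thesis .
  qed
  then have "(\<Sum>e\<in>E. card {(x, y, z). {x, y, z} = e}) \<le> 6 * card E"
    using sum_bounded_above[of E _ "6 :: nat"] by (simp add: mult.commute)
  moreover have "{(x, y, z). {x, y, z} \<in> E} = (\<Union>e\<in>E. {(x, y, z). {x, y, z} = e})" by auto
  ultimately show ?thesis using card_UN_le[OF assms(1), of "\<lambda>e. {(x, y, z). {x, y, z} = e}"] by simp
qed

lemma card_mod_triples:
  "card {(u, v, w) \<in> {..<m * k} \<times> {..<m * k} \<times> {..<m * k}. P (u mod k) (v mod k) (w mod k)}
     = m ^ 3 * (\<Sum>a<k. \<Sum>b<k. \<Sum>c<k. of_bool (P a b c))"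
proof -
  let ?V = "{..<m * k}"
  have "card {t \<in> A. Q t} = (\<Sum>t\<in>A. of_bool (Q t))" if "finite A" for A :: "(nat \<times> nat \<times> nat) set" and Q
    using that by (simp add: of_bool_def flip: sum.inter_filter)
  moreover have "{(u, v, w) \<in> ?V \<times> ?V \<times> ?V. P (u mod k) (v mod k) (w mod k)}
      = {t \<in> ?V \<times> ?V \<times> ?V. case t of (u, v, w) \<Rightarrow> P (u mod k) (v mod k) (w mod k)}"
    by auto
  ultimately have "card {(u, v, w) \<in> ?V \<times> ?V \<times> ?V. P (u mod k) (v mod k) (w mod k)}
      = (\<Sum>(u, v, w)\<in>?V \<times> ?V \<times> ?V. of_bool (P (u mod k) (v mod k) (w mod k)))"
    by (simp add: case_prod_unfold del: mem_Times_iff)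
  also have "\<dots> = (\<Sum>u\<in>?V. \<Sum>v\<in>?V. \<Sum>w\<in>?V. of_bool (P (u mod k) (v mod k) (w mod k)))"
    by (simp only: sum.cartesian_product)
  also have "\<dots> = m ^ 3 * (\<Sum>a<k. \<Sum>b<k. \<Sum>c<k. of_bool (P a b c))"
    \<comment> \<open>Innermost, middle and outermost sum in turn, each contributing a factor
      \<open>m\<close>.\<close>
    using sum_mod_lessThan[of "\<lambda>c. of_bool (P a b c)" k m for a b]
      sum_mod_lessThan[of "\<lambda>b. \<Sum>c<k. of_bool (P a b c)" k m for a]
      sum_mod_lessThan[of "\<lambda>a. \<Sum>b<k. \<Sum>c<k. of_bool (P a b c)" k m]
    by (simp only: power3_eq_cube mult.assoc flip: sum_distrib_left)
  finally show ?thesis .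
qed

text \<open>Each of the three possible coincidences leaves two free coordinates.\<close>

lemma card_degenerate_triples_le:
  assumes "finite V"
  shows "card {(u, v, w) \<in> V \<times> V \<times> V. u = v \<or> u = w \<or> v = w} \<le> 3 * (card V)\<^sup>2"
proof -
  let ?D = "{(u, v, w) \<in> V \<times> V \<times> V. u = v \<or> u = w \<or> v = w}"
  let ?f = "\<lambda>(x, y). (x, x, y)" and ?g = "\<lambda>(x, y). (x, y, x)" and ?h = "\<lambda>(x, y). (y, x, x)"
  have "?D \<subseteq> ?f ` (V \<times> V) \<union> ?g ` (V \<times> V) \<union> ?h ` (V \<times> V)" by (auto simp: image_iff)
  then have "card ?D \<le> card (?f ` (V \<times> V) \<union> ?g ` (V \<times> V) \<union> ?h ` (V \<times> V))"
    using assms by (intro card_mono) auto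
  also have "\<dots> \<le> card (?f ` (V \<times> V)) + card (?g ` (V \<times> V)) + card (?h ` (V \<times> V))"
    by (intro card_Un_le[THEN order_trans] add_mono order_refl)
  also have "\<dots> \<le> card (V \<times> V) + card (V \<times> V) + card (V \<times> V)"
    using assms by (intro add_mono card_image_le) auto
  finally show ?thesis by (simp only: card_cartesian_product power2_eq_square)
qed

lemma card_fano_host_ge: "210 * m ^ 3 \<le> 6 * card (snd (fano_host (m * 7))) + 3 * (m * 7)\<^sup>2"
proof -
  let ?V = "{..<m * 7}" and ?E = "snd (fano_host (m * 7))"
  let ?P = "{(u, v, w) \<in> ?V \<times> ?V \<times> ?V. fano_triple (u mod 7) (v mod 7) (w mod 7)}"
  let ?D = "{(u, v, w) \<in> ?V \<times> ?V \<times> ?V. u = v \<or> u = w \<or> v = w}"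
  let ?O = "{(u, v, w). {u, v, w} \<in> ?E}"
  have E: "card e = 3" "e \<subseteq> ?V" if "e \<in> ?E" for e
    using that by (auto simp: fano_host_def nsets_def)
  have finE: "finite ?E"
    by (auto simp: fano_host_def finite_imp_finite_nsets)
  have "?O \<subseteq> ?V \<times> ?V \<times> ?V" by (auto dest: E(2))
  then have finO: "finite ?O" by (rule finite_subset) auto
  have finD: "finite ?D" by (rule finite_subset[of _ "?V \<times> ?V \<times> ?V"]) auto
  \<comment> \<open>A triple with admissible colours either orders an edge or repeats a
    vertex.\<close>
  have "?P \<subseteq> ?O \<union> ?D" using fano_host_edge_iff by auto
  then have "card ?P \<le> card (?O \<union> ?D)" using finO finD by (intro card_mono) auto
  also have "\<dots> \<le> card ?O + card ?D" by (rule card_Un_le)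
  also have "\<dots> \<le> 6 * card ?E + 3 * (card ?V)\<^sup>2"
    by (intro add_mono card_ordered_triples_le card_degenerate_triples_le finE E(1)) auto
  finally show ?thesis by (simp only: card_mod_triples fano_triple_count card_lessThan mult.commute)
qed

section \<open>Passage to the limit and the numerical comparison\<close>

lemma turan_density_K5_minus_ge: "turan_density K5_minus \<ge> 30 / 49"
proof -
  let ?d = "\<lambda>n. real (ex_number n K5_minus) / real (n choose 3)"
  have "{2, 3, 4} \<in> snd K5_minus" by (auto simp: K5_minus_def nsets_def)
  then have "snd K5_minus \<noteq> {}" by blast
  then have "?d \<longlonglongrightarrow> turan_density K5_minus" by (rule turan_density_LIMSEQ)
  \<comment> \<open>As the full sequence converges, multiples of 7 suffice; \<open>Suc m\<close>
    keeps the denominators positive.\<close>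
  then have "(\<lambda>m. ?d (Suc m * 7)) \<longlonglongrightarrow> turan_density K5_minus"
    using LIMSEQ_subseq_LIMSEQ[of ?d _ "\<lambda>m. Suc m * 7"] by (simp add: strict_mono_def comp_def)
  \<comment> \<open>Here 30/49 = 210/343, and 3/7 = 147/343 comes from the degenerate triples, with
    147 = 3 * 7 * 7.\<close>
  moreover have "(\<lambda>m. 30 / 49 - 3 / 7 * inverse (real (Suc m))) \<longlonglongrightarrow> 30 / 49 - 3 / 7 * 0"
    by (intro tendsto_intros LIMSEQ_inverse_real_of_nat)
  moreover have "30 / 49 - 3 / 7 * inverse (real (Suc m)) \<le> ?d (Suc m * 7)" for m
  proof -
    let ?n = "Suc m * 7"
    define x where "x = real (Suc m)"
    have x: "x > 0" "real ?n = 7 * x" by (simp_all add: x_def)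
    have "card (snd (fano_host ?n)) \<le> ex_number ?n K5_minus"
      using card_le_ex_number[OF three_graph_fano_host fano_host_K5_minus_free, of ?n]
      by (simp add: fano_host_def)
    then have "210 * Suc m ^ 3 \<le> 6 * ex_number ?n K5_minus + 3 * ?n\<^sup>2"
      using card_fano_host_ge[of "Suc m"] by linarith
    then have "real (210 * Suc m ^ 3) \<le> real (6 * ex_number ?n K5_minus + 3 * ?n\<^sup>2)"
      by (simp only: of_nat_le_iff)
    then have ex: "210 * x ^ 3 - 147 * x\<^sup>2 \<le> 6 * real (ex_number ?n K5_minus)"
      using x(2) by (simp add: x_def power_mult_distrib del: mult_Suc of_nat_Suc)
    have "(?n choose 3) * 6 \<le> ?n ^ 3"
      using binomial_fact_pow[of ?n 3] by (simp add: fact_numeral)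
    then have "real ((?n choose 3) * 6) \<le> real (?n ^ 3)" by (simp only: of_nat_le_iff)
    then have "6 * real (?n choose 3) \<le> (7 * x) ^ 3"
      unfolding of_nat_mult[of "?n choose 3"] of_nat_power x(2) by (simp only: mult.commute of_nat_numeral)
    then have choose: "6 * real (?n choose 3) \<le> 343 * x ^ 3" by (simp add: power_mult_distrib)
    have "3 \<le> ?n" by simp
    then have pos: "real (?n choose 3) > 0" by (simp del: mult_Suc)
    have "30 / 49 - 3 / 7 * inverse x = (210 * x ^ 3 - 147 * x\<^sup>2) / (343 * x ^ 3)"
      using x(1) by (simp add: field_simps power2_eq_square power3_eq_cube)
    also have "\<dots> \<le> 6 * real (ex_number ?n K5_minus) / (343 * x ^ 3)"
      using ex x(1) by (intro divide_right_mono) auto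
    also have "\<dots> \<le> 6 * real (ex_number ?n K5_minus) / (6 * real (?n choose 3))"
      using choose pos x(1) by (intro divide_left_mono) (auto simp del: mult_Suc)
    finally show ?thesis by (simp add: x_def del: mult_Suc)
  qed
  ultimately have "30 / 49 - 3 / 7 * 0 \<le> turan_density K5_minus"
    by (intro LIMSEQ_le) blast+
  then show ?thesis by simp
qed

theorem theorem1p5:
  shows "turan_density K5_minus \<ge> (31097 + 277 * sqrt 277) / 59248
    \<and> (0.602673 :: real) \<le> (31097 + 277 * sqrt 277) / 59248
    \<and> (31097 + 277 * sqrt 277) / 59248 < (0.602674 :: real)"
proof -
  \<comment> \<open>The two decimal bounds require \<open>sqrt 277\<close> to lie between
    16.64321... and 16.64342...; the upper estimate also places the constant below 30/49.\<close>
  have "16.64325 < sqrt 277" by (rule real_less_rsqrt) (simp add: power2_eq_square)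
  moreover have "sqrt 277 < 16.6434" by (rule real_less_lsqrt) (simp_all add: power2_eq_square)
  ultimately show ?thesis using turan_density_K5_minus_ge by simp
qed

end
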